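(* Let $n\ge 2$ and let $\mathcal{P}$ be a regular $n$-crosspolytope inscribed in a unit $n$-sphere. Let $k$ be the number of distinct chord lengths of $\mathcal{P}$ and let $d_1,\dots,d_k$ be these distinct chord lengths. Then $$\prod_{i=1}^{k}d_i^2=8 .$$
   Context: A unit $n$-sphere is a sphere of radius $1$ in $\mathbb{R}^n$ (so a "2-sphere" is a circle). A regular polytope is inscribed in it if all vertices lie on the sphere, whose center is the center of the polytope. The regular $n$-crosspolytope is the regular convex polytope in $\mathbb{R}^n$ that is the convex hull of the $2n$ points lying at a common distance from a point $\mathbf{O}$ on $n$ mutually orthogonal lines through $\mathbf{O}$ (for $n=2$ the square, for $n=3$ the octahedron). A chord is a line segment whose endpoints are two distinct vertices of the polytope (so chords are all edges and all diagonals). *)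

theory Defs
  imports "HOL-Analysis.Analysis"
begin

definition axis_points :: "real ^ 'n \<Rightarrow> real \<Rightarrow> real ^ 'n \<Rightarrow> (real ^ 'n) set" where
  "axis_points c r w = {x \<in> range (\<lambda>t. c + t *\<^sub>R w). dist c x = r}"

text \<open>The lines are indexed by the type \<open>'n\<close>, so there are exactly as many of them as the
  dimension; \<open>u i\<close> is a direction vector, not necessarily of length one, of the \<open>i\<close>-th line
  through the center \<open>c\<close>.\<close>

definition regular_crosspolytope :: "real ^ 'n \<Rightarrow> (real ^ 'n) set \<Rightarrow> bool" where
  "regular_crosspolytope c P \<longleftrightarrow>
    (\<exists>r u. r > 0 \<and> (\<forall>i::'n. u i \<noteq> 0) \<and> (\<forall>i j. i \<noteq> j \<longrightarrow> orthogonal (u i) (u j)) \<and>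
       P = convex hull (\<Union>i. axis_points c r (u i)))"

definition vertices :: "(real ^ 'n) set \<Rightarrow> (real ^ 'n) set" where
  "vertices P = {v. v extreme_point_of P}"

definition chord_lengths :: "(real ^ 'n) set \<Rightarrow> real set" where
  "chord_lengths P = {dist v w | v w. v \<in> vertices P \<and> w \<in> vertices P \<and> v \<noteq> w}"

text \<open>Finiteness ensures that the chord lengths can be enumerated and that their number is
  given by \<^const>\<open>card\<close>.\<close>

lemma finite_axis_points:
  assumes "w \<noteq> 0"
  shows "finite (axis_points c r w)"
proof -
  have "axis_points c r w \<subseteq> {c + (r / norm w) *\<^sub>R w, c + (- r / norm w) *\<^sub>R w}"
  proof
    fix x assume "x \<in> axis_points c r w"
    then obtain t where x: "x = c + t *\<^sub>R w" and "dist c x = r"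
      by (auto simp: axis_points_def)
    then have "\<bar>t\<bar> * norm w = r" by (simp add: dist_norm)
    then have "t = r / norm w \<or> t = - r / norm w"
      using assms by (auto simp: field_simps abs_if split: if_splits)
    then show "x \<in> {c + (r / norm w) *\<^sub>R w, c + (- r / norm w) *\<^sub>R w}"
      using x by blast
  qed
  then show ?thesis by (rule finite_subset) simp
qed

lemma finite_chord_lengths:
  assumes "regular_crosspolytope c P"
  shows "finite (chord_lengths P)"
proof -
  obtain r and u :: "'a \<Rightarrow> real ^ 'a" where u: "\<And>i. u i \<noteq> 0"
    and P: "P = convex hull (\<Union>i. axis_points c r (u i))"
    using assms unfolding regular_crosspolytope_def by blast
  have "vertices P \<subseteq> (\<Union>i. axis_points c r (u i))"
    unfolding vertices_def P using extreme_point_of_convex_hull by blast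
  moreover have "finite (\<Union>i. axis_points c r (u i))"
    using u by (simp add: finite_axis_points)
  ultimately have "finite (vertices P)" by (rule finite_subset)
  then have "finite ((\<lambda>(v, w). dist v w) ` (vertices P \<times> vertices P))" by blast
  then show ?thesis
    by (rule rev_finite_subset) (auto simp: chord_lengths_def)
qed

end

theory Submission
  imports Defs
begin

text \<open>
  Let \<open>\<plusminus>e\<^sub>i\<close> be the unit vectors along the \<open>n\<close> orthogonal lines.  The polytope is the convex hull of
  the \<open>2n\<close> points \<open>c \<plusminus> r e\<^sub>i\<close>.  These points all lie on one sphere, and a Euclidean ball is strictly
  convex, so none of them is redundant: the vertices are exactly the points \<open>c \<plusminus> r e\<^sub>i\<close>
  (\<open>vertices_hull_in_sphere\<close>, \<open>axis_points_eq\<close>).  Inscription in the unit sphere forces \<open>r = 1\<close>.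
  Two distinct vertices are either antipodal, at distance \<open>2\<close>, or lie on different axes, and then
  Pythagoras gives the distance \<open>\<surd>2\<close>.  The second case occurs because \<open>n \<ge> 2\<close>, so the set of
  chord lengths is \<open>{2, \<surd>2}\<close> (\<open>chord_lengths_crosspolytope\<close>), and the product of the squares
  is \<open>4 \<cdot> 2 = 8\<close>.
\<close>

lemma axis_points_eq:
  assumes "w \<noteq> 0" "r \<ge> 0"
  shows "axis_points c r w = {c + r *\<^sub>R sgn w, c - r *\<^sub>R sgn w}"
proof
  show "axis_points c r w \<subseteq> {c + r *\<^sub>R sgn w, c - r *\<^sub>R sgn w}"
  proof
    fix x assume "x \<in> axis_points c r w"
    then obtain t where x: "x = c + t *\<^sub>R w" and "dist c x = r"
      by (auto simp: axis_points_def)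
    then have "\<bar>t\<bar> * norm w = r" by (simp add: dist_norm)
    then have "t = r / norm w \<or> t = - (r / norm w)"
      using assms by (auto simp: field_simps abs_if split: if_splits)
    then show "x \<in> {c + r *\<^sub>R sgn w, c - r *\<^sub>R sgn w}"
      using x by (auto simp: sgn_div_norm divide_inverse)
  qed
  have "c + r *\<^sub>R sgn w = c + (r / norm w) *\<^sub>R w" "c - r *\<^sub>R sgn w = c + (- (r / norm w)) *\<^sub>R w"
    by (simp_all add: sgn_div_norm divide_inverse)
  then have "c + r *\<^sub>R sgn w \<in> range (\<lambda>t. c + t *\<^sub>R w)"
    "c - r *\<^sub>R sgn w \<in> range (\<lambda>t. c + t *\<^sub>R w)"
    by blast+
  then show "{c + r *\<^sub>R sgn w, c - r *\<^sub>R sgn w} \<subseteq> axis_points c r w"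
    using assms by (simp add: axis_points_def dist_norm norm_sgn)
qed

text \<open>
  A point on a sphere cannot lie strictly between two points of the ball, because the distance to
  the center drops below the larger of the two end distances inside a segment.
\<close>
lemma vertices_hull_in_sphere:
  fixes c :: "real ^ 'n"
  assumes "S \<subseteq> sphere c r"
  shows "vertices (convex hull S) = S"
proof
  show "vertices (convex hull S) \<subseteq> S"
    unfolding vertices_def using extreme_point_of_convex_hull by blast
  have ball: "convex hull S \<subseteq> cball c r"
    using assms by (intro hull_minimal) auto
  have "v extreme_point_of (convex hull S)" if "v \<in> S" for v
    unfolding extreme_point_of_def
  proof (intro conjI ballI notI)
    show "v \<in> convex hull S" using that by (rule hull_inc)
    fix a b assume ab: "a \<in> convex hull S" "b \<in> convex hull S" and "v \<in> open_segment a b"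
    then have "dist c v < dist c a \<or> dist c v < dist c b"
      using dist_decreases_open_segment by blast
    moreover have "dist c a \<le> r" "dist c b \<le> r" "dist c v = r"
      using ab ball assms that by auto
    ultimately show False by linarith
  qed
  then show "S \<subseteq> vertices (convex hull S)"
    unfolding vertices_def by blast
qed

lemma dist_orthogonal_unit_vectors:
  fixes x y :: "'a :: real_inner"
  assumes "norm x = 1" "norm y = 1" "orthogonal x y"
  shows "dist x y = sqrt 2"
proof -
  have "(dist x y)\<^sup>2 = 2"
    using assms norm_add_Pythagorean[of x "- y"] by (simp add: dist_norm orthogonal_clauses)
  then show ?thesis by (metis real_sqrt_unique zero_le_dist)
qed

lemma chord_lengths_crosspolytope:
  fixes P :: "(real ^ 'n) set"
  assumes "CARD('n) \<ge> 2" "regular_crosspolytope c P" "vertices P \<subseteq> sphere c 1"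
  shows "chord_lengths P = {2, sqrt 2}"
proof -
  obtain r and u :: "'n \<Rightarrow> real ^ 'n" where r: "r > 0" and u: "\<And>i. u i \<noteq> 0"
    and orth: "\<And>i j. i \<noteq> j \<Longrightarrow> orthogonal (u i) (u j)"
    and P: "P = convex hull (\<Union>i. axis_points c r (u i))"
    using assms(2) unfolding regular_crosspolytope_def by blast
  define e where "e = (\<lambda>i. sgn (u i))"
  have e: "norm (e i) = 1" for i using u by (simp add: e_def norm_sgn)
  have eorth: "orthogonal (e i) (e j)" if "i \<noteq> j" for i j
    using orth[OF that] by (simp add: e_def sgn_div_norm orthogonal_def)
  have "(\<Union>i. axis_points c r (u i)) \<subseteq> sphere c r"
    by (auto simp: axis_points_def)
  then have "vertices P = (\<Union>i. axis_points c r (u i))"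
    unfolding P by (rule vertices_hull_in_sphere)
  then have V: "vertices P = (\<Union>i. {c + r *\<^sub>R e i, c - r *\<^sub>R e i})"
    using u r by (simp add: axis_points_eq e_def)
  have "r = 1"
  proof -
    have "c + r *\<^sub>R e undefined \<in> sphere c 1" using V assms(3) by blast
    then show ?thesis using r e by (simp add: dist_norm)
  qed
  with V have V: "vertices P = (\<Union>i. {c + e i, c - e i})" by simp
  have antipodal: "dist (c + e i) (c - e i) = 2" for i
  proof -
    have "c + e i - (c - e i) = 2 *\<^sub>R e i" by (simp add: scaleR_2)
    then show ?thesis using e by (simp add: dist_norm)
  qed
  have adjacent: "dist (c + x) (c + y) = sqrt 2"
    if "i \<noteq> j" "x \<in> {e i, - e i}" "y \<in> {e j, - e j}" for i j x y
    using that eorth[OF that(1)] e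
    by (auto intro!: dist_orthogonal_unit_vectors simp: orthogonal_clauses)
  have vertex_cases: "\<exists>i. \<exists>x\<in>{e i, - e i}. v = c + x" if "v \<in> vertices P" for v
    using that V by auto
  have "dist v w \<in> {2, sqrt 2}" if vw: "v \<in> vertices P" "w \<in> vertices P" "v \<noteq> w" for v w
  proof -
    obtain i x where v: "v = c + x" "x \<in> {e i, - e i}"
      using vertex_cases[OF vw(1)] by blast
    obtain j y where w: "w = c + y" "y \<in> {e j, - e j}"
      using vertex_cases[OF vw(2)] by blast
    show ?thesis
    proof (cases "i = j")
      case True
      then have "v = c + e i \<and> w = c - e i \<or> v = c - e i \<and> w = c + e i"
        using v w vw(3) by auto
      then have "dist v w = 2" using antipodal[of i] by (metis dist_commute)
      then show ?thesis by simp
    next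
      case False
      then have "dist v w = sqrt 2" unfolding v(1) w(1) using v(2) w(2) by (rule adjacent)
      then show ?thesis by simp
    qed
  qed
  then have "chord_lengths P \<subseteq> {2, sqrt 2}" unfolding chord_lengths_def by blast
  moreover have "2 \<in> chord_lengths P"
  proof -
    have "c + e undefined \<in> vertices P" "c - e undefined \<in> vertices P" using V by auto
    moreover have "c + e undefined \<noteq> c - e undefined"
      using antipodal[of undefined] by (metis dist_self zero_neq_numeral)
    ultimately show ?thesis
      unfolding chord_lengths_def using antipodal[of undefined, symmetric] by blast
  qed
  moreover have "sqrt 2 \<in> chord_lengths P"
  proof -
    obtain i j :: 'n where "i \<noteq> j"
      using assms(1) card_le_Suc0_iff_eq[of "UNIV :: 'n set"] by fastforce
    then have "sqrt 2 = dist (c + e i) (c + e j)"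
      using adjacent[of i j "e i" "e j"] by simp
    moreover from this have "c + e i \<noteq> c + e j" by auto
    moreover have "c + e i \<in> vertices P" "c + e j \<in> vertices P" using V by auto
    ultimately show ?thesis unfolding chord_lengths_def by blast
  qed
  ultimately show ?thesis by blast
qed

theorem theorem6p1:
  fixes P :: "(real ^ 'n) set" and c :: "real ^ 'n" and k :: nat and d :: "nat \<Rightarrow> real"
  assumes "CARD('n) \<ge> 2"
    and "regular_crosspolytope c P"
    and "vertices P \<subseteq> sphere c 1"
    and "k = card (chord_lengths P)"
    and "bij_betw d {1..k} (chord_lengths P)"
  shows "(\<Prod>i=1..k. (d i)\<^sup>2) = 8"
proof -
  have "(\<Prod>i=1..k. (d i)\<^sup>2) = (\<Prod>x\<in>chord_lengths P. x\<^sup>2)"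
    using assms(5) by (rule prod.reindex_bij_betw)
  also have "\<dots> = (\<Prod>x\<in>{2, sqrt 2}. x\<^sup>2)"
    using chord_lengths_crosspolytope[OF assms(1-3)] by simp
  also have "\<dots> = 8"
  proof -
    have "(2::real) \<noteq> sqrt 2" using sqrt2_less_2 by simp
    then show ?thesis by simp
  qed
  finally show ?thesis .
qed

end
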